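(* For every real $s>0$, the function $\mathfrak{m}$ satisfies the integral equation $$\mathfrak{m}(-s)=(2e^{s}-1)\int_{0}^{\infty}\mathfrak{m}'(-t)\,J_{0}(2\sqrt{st})\,dt .$$
   Context: $F:[0,\infty)\to[0,1)$ is the (rescaled) Minkowski question mark function: if $x=[a_0,a_1,a_2,\dots]$ is the regular continued fraction expansion of $x\ge 0$, then $$F(x)=1-2^{-a_{0}}+2^{-(a_{0}+a_{1})}-2^{-(a_{0}+a_{1}+a_{2})}+\cdots,$$ where for rational $x=[a_0,\dots,a_n]$ the sum terminates at the last element $a_n$. $F$ is a continuous, monotone distribution function with $F(0)=0$, $F(\infty)=1$. The entire function $\mathfrak{m}$ is defined by $$\mathfrak{m}(t)=\int_{0}^{\infty}\exp\left(\frac{xt}{x+1}\right)dF(x)$$ (Stieltjes integral), $\mathfrak{m}'$ is its derivative, and $\mathfrak{m}'(-t)$ means $\mathfrak{m}'$ evaluated at $-t$. $J_0$ is the Bessel function $J_{0}(z)=\frac{1}{\pi}\int_{0}^{\pi}\cos(z\sin x)\,dx$. *)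

theory Defs
  imports "HOL-Complex_Analysis.Complex_Analysis" "HOL-Probability.Probability"
begin

primrec complete_quotient :: "real \<Rightarrow> nat \<Rightarrow> real" where
  "complete_quotient x 0 = x"
| "complete_quotient x (Suc n) = 1 / frac (complete_quotient x n)"

definition cf_elem :: "real \<Rightarrow> nat \<Rightarrow> nat" where
  "cf_elem x n = nat \<lfloor>complete_quotient x n\<rfloor>"

text \<open>The continued fraction algorithm stops at the first integral complete quotient. Beyond that
  point \<^const>\<open>complete_quotient\<close> only produces junk values (\<open>1 / 0 = 0\<close>), which are masked by the
  following predicate: it holds iff the expansion of \<open>x\<close> has an element with index \<open>n\<close>.\<close>

definition cf_index :: "real \<Rightarrow> nat \<Rightarrow> bool" where
  "cf_index x n \<longleftrightarrow> (\<forall>k<n. complete_quotient x k \<notin> \<int>)"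

text \<open>The extension by \<open>0\<close> to the negative half-line turns the function into a distribution function
  on the whole line, as \<^const>\<open>interval_measure\<close> requires.\<close>

definition minkowski_F :: "real \<Rightarrow> real" where
  "minkowski_F x =
    (if x < 0 then 0
     else 1 + (\<Sum>n. if cf_index x n then (-1) ^ Suc n * (1/2) ^ (\<Sum>k\<le>n. cf_elem x k) else 0))"

definition minkowski_m :: "complex \<Rightarrow> complex" where
  "minkowski_m t =
    (LINT x:{0..}|interval_measure minkowski_F. exp (complex_of_real x * t / (complex_of_real x + 1)))"

definition bessel_J0 :: "real \<Rightarrow> real" where
  "bessel_J0 z = 1 / pi * integral {0..pi} (\<lambda>x. cos (z * sin x))"

end

theory Submission
  imports Defs
begin

text \<open>
  Write \<open>F\<close> for the distribution function, \<open>\<mu>\<close> for its measure, \<open>y = x / (x + 1)\<close>, and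
  \<open>L(s) = \<integral> e\<^sup>-\<^sup>s\<^sup>x d\<mu>\<close>. The continued fraction shift gives \<open>F(x + 1) = (1 + F(x)) / 2\<close> and
  \<open>F(1 / x) = 1 - F(x)\<close>. Hence \<open>\<mu>\<close> is invariant under \<open>x \<mapsto> 1 / x\<close>, and it is the average of its images
  under \<open>x \<mapsto> x + 1\<close> and \<open>x \<mapsto> x / (x + 1)\<close>; integrating \<open>e\<^sup>-\<^sup>s\<^sup>x\<close> yields \<open>m(-s) = (2 - e\<^sup>-\<^sup>s) L(s)\<close>.
  On the other side \<open>m'(-t) = \<integral> y e\<^sup>-\<^sup>y\<^sup>t d\<mu>\<close>, and since \<open>\<bar>J\<^sub>0\<bar> \<le> 1\<close>, Fubini together with the Laplace transform
  \<open>\<integral> e\<^sup>-\<^sup>y\<^sup>t J\<^sub>0(2 sqrt(s t)) dt = e\<^sup>-\<^sup>s\<^sup>/\<^sup>y / y\<close> turns the right-hand integral into \<open>\<integral> e\<^sup>-\<^sup>s\<^sup>/\<^sup>y d\<mu>\<close>.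
  As \<open>1 / y = 1 + 1 / x\<close>, invariance under inversion gives \<open>e\<^sup>-\<^sup>s L(s)\<close> for it.
\<close>

section \<open>The Minkowski question mark function\<close>

definition cf_term :: "real \<Rightarrow> nat \<Rightarrow> real" where
  "cf_term x n = (if cf_index x n then (-1) ^ Suc n * (1/2) ^ (\<Sum>k\<le>n. cf_elem x k) else 0)"

lemma minkowski_F_eq: "x \<ge> 0 \<Longrightarrow> minkowski_F x = 1 + (\<Sum>n. cf_term x n)"
  by (simp add: minkowski_F_def cf_term_def)

text \<open>Such an element is the floor of the reciprocal of a fractional part in (0, 1). Index 0
  is excluded because the integer part of \<open>x\<close> may vanish.\<close>

lemma cf_elem_pos:
  assumes "cf_index x n" "0 < k" "k \<le> n"
  shows "cf_elem x k \<ge> 1"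
proof -
  obtain j where j: "k = Suc j" using assms(2) gr0_implies_Suc by auto
  have "complete_quotient x j \<notin> \<int>" using assms j by (auto simp: cf_index_def)
  hence "0 < frac (complete_quotient x j)" "frac (complete_quotient x j) < 1"
    by (simp_all add: frac_lt_1)
  hence "complete_quotient x k \<ge> 1" by (simp add: j)
  thus ?thesis by (simp add: cf_elem_def le_nat_iff)
qed

text \<open>Elements with index 1 to \<open>n\<close> are positive, so the exponent is at least
  \<open>n\<close>; element 0 may contribute nothing.\<close>

lemma norm_cf_term_le: "norm (cf_term x n) \<le> (1/2) ^ n"
proof (cases "cf_index x n")
  case True
  have "n = (\<Sum>k\<in>{1..n}. 1)" by simp
  also have "\<dots> \<le> (\<Sum>k\<in>{1..n}. cf_elem x k)"
    by (rule sum_mono) (use cf_elem_pos[OF True] in auto)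
  also have "\<dots> \<le> (\<Sum>k\<le>n. cf_elem x k)" by (rule sum_mono2) auto
  finally have "(1/2::real) ^ (\<Sum>k\<le>n. cf_elem x k) \<le> (1/2) ^ n"
    by (rule power_decreasing) auto
  thus ?thesis using True by (simp add: cf_term_def abs_mult power_abs)
qed (simp add: cf_term_def)

lemma summable_cf_term: "summable (cf_term x)"
  by (rule summable_comparison_test[of _ "\<lambda>n. (1/2) ^ n"])
    (use norm_cf_term_le in \<open>auto simp: summable_geometric\<close>)

text \<open>A crude geometric bound, which starts the induction in
  \<open>minkowski_F_range\<close>.\<close>

lemma abs_minkowski_F_diff_le: "x \<ge> 0 \<Longrightarrow> \<bar>minkowski_F x - 1\<bar> \<le> 2"
proof -
  assume "x \<ge> 0"
  have "norm (\<Sum>n. cf_term x n) \<le> (\<Sum>n. (1/2) ^ n)"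
    by (rule norm_suminf_le[OF norm_cf_term_le]) (simp add: summable_geometric)
  also have "\<dots> = 2" by (subst suminf_geometric) auto
  finally show ?thesis using minkowski_F_eq[OF \<open>x \<ge> 0\<close>] by simp
qed

section \<open>The functional equations\<close>

text \<open>\<open>frac\<close> ignores integer shifts; only the quotient with index 0 sees the
  shift.\<close>

lemma complete_quotient_plus1: "complete_quotient (x + 1) (Suc n) = complete_quotient x (Suc n)"
  by (induction n) (auto simp: frac_1_eq)

lemma cf_index_plus1: "cf_index (x + 1) n = cf_index x n"
proof -
  have "complete_quotient (x + 1) k \<in> \<int> \<longleftrightarrow> complete_quotient x k \<in> \<int>" for k
  proof (cases k)
    case 0
    then show ?thesis by (metis Ints_1 Ints_add Ints_diff add_diff_cancel_right' complete_quotient.simps(1))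
  next
    case (Suc j)
    then show ?thesis by (simp only: complete_quotient_plus1)
  qed
  thus ?thesis by (simp add: cf_index_def)
qed

lemma sum_cf_elem_plus1:
  assumes "x \<ge> 0"
  shows "(\<Sum>k\<le>n. cf_elem (x + 1) k) = Suc (\<Sum>k\<le>n. cf_elem x k)"
proof (induction n)
  case 0
  have "0 \<le> \<lfloor>x\<rfloor>" using assms by simp
  hence "nat (\<lfloor>x\<rfloor> + 1) = Suc (nat \<lfloor>x\<rfloor>)" by linarith
  thus ?case by (simp add: cf_elem_def)
next
  case (Suc n)
  have "cf_elem (x + 1) (Suc n) = cf_elem x (Suc n)"
    unfolding cf_elem_def complete_quotient_plus1 ..
  thus ?case using Suc by simp
qed

text \<open>Adding 1 raises element 0 alone, so every exponent grows by one and every term is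
  halved.\<close>

lemma minkowski_F_plus1:
  assumes "x \<ge> 0"
  shows "minkowski_F (x + 1) = (1 + minkowski_F x) / 2"
proof -
  have "cf_term (x + 1) n = 1/2 * cf_term x n" for n
    by (simp add: cf_term_def cf_index_plus1 sum_cf_elem_plus1[OF assms])
  hence "cf_term (x + 1) = (\<lambda>n. 1/2 * cf_term x n)" by blast
  hence "(\<Sum>n. cf_term (x + 1) n) = 1/2 * (\<Sum>n. cf_term x n)"
    using suminf_mult[OF summable_cf_term, of "1/2"] by metis
  thus ?thesis using assms by (simp add: minkowski_F_eq)
qed

lemma minkowski_F_0 [simp]: "minkowski_F 0 = 0"
proof -
  have "cf_term 0 n = (if n = 0 then -1 else 0)" for n
    by (cases n) (auto simp: cf_term_def cf_index_def cf_elem_def)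
  hence "cf_term 0 = (\<lambda>n. if n = 0 then -1 else 0)" by blast
  thus ?thesis using sums_unique[OF sums_single[of 0 "\<lambda>_. -1 :: real"]] by (simp add: minkowski_F_eq)
qed

lemma minkowski_F_1 [simp]: "minkowski_F 1 = 1/2"
  using minkowski_F_plus1[of 0] by simp

lemma minkowski_F_neg: "x < 0 \<Longrightarrow> minkowski_F x = 0"
  by (simp add: minkowski_F_def)

text \<open>The expansion of \<open>1 / x\<close> is that of \<open>x\<close> with a 0 put in front:
  this adds the term -1 and moves all other terms one place, which flips their signs.\<close>

lemma minkowski_F_inverse_gt1:
  assumes "x > 1"
  shows "minkowski_F (1 / x) = 1 - minkowski_F x"
proof -
  have fr: "frac (1 / x) = 1 / x" using assms by (simp add: frac_eq)
  have cq: "complete_quotient (1 / x) (Suc n) = complete_quotient x n" for n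
    by (induction n) (use fr in auto)
  have nI: "1 / x \<notin> \<int>" 
  proof
    assume "1 / x \<in> \<int>"
    hence "frac (1 / x) = 0" by (simp add: frac_eq_0_iff)
    thus False using fr assms by simp
  qed
  have ci: "cf_index (1 / x) (Suc n) = cf_index x n" for n
    unfolding cf_index_def All_less_Suc2 using nI by (simp add: cq del: complete_quotient.simps(2))
  have ce0: "cf_elem (1 / x) 0 = 0" using assms fr by (simp add: cf_elem_def frac_def)
  have ce: "cf_elem (1 / x) (Suc n) = cf_elem x n" for n by (simp add: cf_elem_def cq del: complete_quotient.simps(2))
  have t: "cf_term (1 / x) (Suc n) = - cf_term x n" for n
    unfolding cf_term_def ci sum.atMost_Suc_shift by (simp add: ce0 ce)
  have t0: "cf_term (1 / x) 0 = -1"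
    by (simp add: cf_term_def cf_index_def ce0)
  have "(\<Sum>n. cf_term (1 / x) n) = -1 + (\<Sum>n. cf_term (1 / x) (Suc n))"
    using suminf_split_head[OF summable_cf_term[of "1/x"]] t0 by simp
  also have "\<dots> = -1 - (\<Sum>n. cf_term x n)"
    by (simp add: t suminf_minus[OF summable_cf_term])
  finally show ?thesis using assms by (simp add: minkowski_F_eq)
qed

lemma minkowski_F_inverse:
  assumes "x > 0"
  shows "minkowski_F (1 / x) = 1 - minkowski_F x"
proof -
  consider "x > 1" | "x = 1" | "x < 1" by linarith
  then show ?thesis
  proof cases
    case 3
    then have "1 / x > 1" using assms by simp
    from minkowski_F_inverse_gt1[OF this] show ?thesis by simp
  qed (use minkowski_F_inverse_gt1 in auto)
qed

lemma minkowski_F_ge1: "x \<ge> 1 \<Longrightarrow> minkowski_F x = (1 + minkowski_F (x - 1)) / 2"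
  using minkowski_F_plus1[of "x - 1"] by simp

text \<open>Inversion followed by the shift equation at \<open>1 / x\<close>. Together with
  \<open>minkowski_F_ge1\<close> this runs a slow continued fraction algorithm in which each step
  contributes a factor 1/2.\<close>

lemma minkowski_F_le1:
  assumes "0 < x" "x \<le> 1"
  shows "minkowski_F x = (1 - minkowski_F (1 / x - 1)) / 2"
  using minkowski_F_inverse[OF assms(1)] minkowski_F_ge1[of "1 / x"] assms
  by (simp add: field_simps)

text \<open>Each application of the two functional equations halves the distance of the value to the
  unit interval; monotonicity and continuity below are contraction arguments of the same kind.\<close>

lemma minkowski_F_range: "0 \<le> minkowski_F x" "minkowski_F x \<le> 1"
proof -
  have "\<forall>x\<ge>0. - 2 * (1/2) ^ n \<le> minkowski_F x \<and> minkowski_F x \<le> 1 + 2 * (1/2) ^ n" for n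
  proof (induction n)
    case 0
    then show ?case using abs_minkowski_F_diff_le by (auto simp: abs_le_iff) (smt (verit))+
  next
    case (Suc n)
    show ?case
    proof (intro allI impI)
      fix x :: real
      assume "x \<ge> 0"
      then consider "x = 0" | "0 < x" "x \<le> 1" | "x > 1" by linarith
      then show "- 2 * (1/2) ^ Suc n \<le> minkowski_F x \<and> minkowski_F x \<le> 1 + 2 * (1/2) ^ Suc n"
      proof cases
        case 2
        then have "1 / x - 1 \<ge> 0" by simp
        with Suc have "- 2 * (1/2) ^ n \<le> minkowski_F (1 / x - 1) \<and> minkowski_F (1 / x - 1) \<le> 1 + 2 * (1/2) ^ n"
          by blast
        with 2 show ?thesis by (simp add: minkowski_F_le1)
      next
        case 3
        with Suc have "- 2 * (1/2) ^ n \<le> minkowski_F (x - 1) \<and> minkowski_F (x - 1) \<le> 1 + 2 * (1/2) ^ n"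
          by simp
        with 3 show ?thesis by (simp add: minkowski_F_ge1)
      qed auto
    qed
  qed
  note * = this
  have lim: "(\<lambda>n. 2 * (1/2::real) ^ n) \<longlonglongrightarrow> 2 * 0"
    by (intro tendsto_intros LIMSEQ_realpow_zero) auto
  have "x \<ge> 0 \<Longrightarrow> 0 \<le> minkowski_F x"
    using LIMSEQ_le_const2[OF tendsto_minus[OF lim], of "minkowski_F x"] * by auto
  thus "0 \<le> minkowski_F x" using minkowski_F_neg[of x] by fastforce
  have "x \<ge> 0 \<Longrightarrow> minkowski_F x \<le> 1"
    using LIMSEQ_le_const[OF tendsto_add[OF tendsto_const lim], of "minkowski_F x" 1] * by auto
  thus "minkowski_F x \<le> 1" using minkowski_F_neg[of x] by fastforce
qed

section \<open>Monotonicity and continuity\<close>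

text \<open>A possible decrease is halved whenever both points lie on the same side of 1, hence is
  at most \<open>(1/2) ^ n\<close> for every \<open>n\<close>. If 1 separates the points, their
  values are separated by 1/2.\<close>

lemma minkowski_F_mono_nonneg:
  assumes "0 \<le> x" "x \<le> y"
  shows "minkowski_F x \<le> minkowski_F y"
proof -
  have "\<forall>x\<ge>0. \<forall>y\<ge>x. minkowski_F x - minkowski_F y \<le> (1/2) ^ n" for n
  proof (induction n)
    case 0
    show ?case using minkowski_F_range by (auto) (smt (verit))
  next
    case (Suc n)
    show ?case
    proof (intro allI impI)
      fix x y :: real
      assume xy: "x \<ge> 0" "y \<ge> x"
      then consider "x = 0" | "0 < x" "y \<le> 1" | "x \<le> 1" "y \<ge> 1" "x > 0" | "x > 1" by linarith
      then show "minkowski_F x - minkowski_F y \<le> (1/2) ^ Suc n"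
      proof cases
        case 1
        hence "minkowski_F x - minkowski_F y \<le> 0" using minkowski_F_range(1)[of y] by simp
        also have "0 \<le> (1/2::real) ^ Suc n" by simp
        finally show ?thesis .
      next
        case 2
        \<comment> \<open>The points swap order here, which the minus sign in
          \<open>minkowski_F_le1\<close> undoes.\<close>
        then have "1 / y - 1 \<ge> 0" "1 / x - 1 \<ge> 1 / y - 1" using xy by (auto simp: frac_le)
        with Suc have "minkowski_F (1 / y - 1) - minkowski_F (1 / x - 1) \<le> (1/2) ^ n" by blast
        with 2 xy show ?thesis by (simp add: minkowski_F_le1 diff_divide_distrib)
      next
        case 3
        then have "minkowski_F x \<le> 1/2" "minkowski_F y \<ge> 1/2"
          using minkowski_F_range by (auto simp: minkowski_F_le1 minkowski_F_ge1)
        moreover have "0 \<le> (1/2::real) ^ Suc n" by simp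
        ultimately show ?thesis by linarith
      next
        case 4
        with Suc xy have "minkowski_F (x - 1) - minkowski_F (y - 1) \<le> (1/2) ^ n" by auto
        with 4 xy show ?thesis by (simp add: minkowski_F_ge1 add_divide_distrib)
      qed
    qed
  qed
  hence "\<exists>N. \<forall>n\<ge>N. minkowski_F x - minkowski_F y \<le> (1/2) ^ n" using assms by auto
  moreover have "(\<lambda>n. (1/2::real) ^ n) \<longlonglongrightarrow> 0"
    by (intro LIMSEQ_realpow_zero) auto
  ultimately show ?thesis using LIMSEQ_le_const by fastforce
qed

lemma minkowski_F_mono: "x \<le> y \<Longrightarrow> minkowski_F x \<le> minkowski_F y"
  using minkowski_F_mono_nonneg[of x y] minkowski_F_neg[of x] minkowski_F_range(1)[of y]
  by (cases "x < 0") auto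

lemma minkowski_F_of_nat: "minkowski_F (real n) = 1 - (1/2) ^ n"
proof (induction n)
  case (Suc n)
  thus ?case using minkowski_F_plus1[of "real n"] by (simp add: add.commute)
qed simp

text \<open>The functional equations carry an interval around \<open>x - 1\<close> or
  \<open>1 / x - 1\<close> to one around \<open>x\<close> with half the variation. The points 0 and
  1, where no branch gives a two-sided interval, get explicit ones. The left end may touch
  \<open>x\<close> only at 0.\<close>

lemma minkowski_F_small_interval:
  assumes "x \<ge> 0"
  obtains a b where "0 \<le> a" "a \<le> x" "x > 0 \<Longrightarrow> a < x" "x < b" "minkowski_F b - minkowski_F a \<le> (1/2) ^ n"
proof -
  have "\<forall>x\<ge>0. \<exists>a b. 0 \<le> a \<and> a \<le> x \<and> (x > 0 \<longrightarrow> a < x) \<and> x < b \<and>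
          minkowski_F b - minkowski_F a \<le> (1/2) ^ n" for n
  proof (induction n)
    case 0
    show ?case
    proof (intro allI impI)
      fix x :: real assume "0 \<le> x"
      thus "\<exists>a b. 0 \<le> a \<and> a \<le> x \<and> (x > 0 \<longrightarrow> a < x) \<and> x < b \<and>
          minkowski_F b - minkowski_F a \<le> (1/2) ^ 0"
        using minkowski_F_range(1)[of 0] minkowski_F_range(2)[of "x+1"]
        by (intro exI[of _ 0] exI[of _ "x + 1"]) auto
    qed
  next
    case (Suc n)
    show ?case
    proof (intro allI impI)
      fix x :: real assume "0 \<le> x"
      \<comment> \<open>Inverting the integer \<open>n + 2\<close> gives a point near 0 whose value
        is already below the target; it serves both \<open>x = 0\<close> and
        \<open>x = 1\<close>.\<close>
      define c :: real where "c = 1 / real (Suc (Suc n))"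
      have c: "c > 0" "minkowski_F c = (1/2) ^ Suc (Suc n)"
        using minkowski_F_inverse[of "real (Suc (Suc n))"] minkowski_F_of_nat[of "Suc (Suc n)"]
        by (simp_all add: c_def)
      consider "x = 0" | "0 < x" "x < 1" | "x = 1" | "x > 1" using \<open>0 \<le> x\<close> by linarith
      then show "\<exists>a b. 0 \<le> a \<and> a \<le> x \<and> (x > 0 \<longrightarrow> a < x) \<and> x < b \<and>
          minkowski_F b - minkowski_F a \<le> (1/2) ^ Suc n"
      proof cases
        case 1
        then show ?thesis using c
          by (intro exI[of _ 0] exI[of _ c]) (auto simp: field_simps)
      next
        case 2
        then have "1 / x - 1 > 0" by simp
        with Suc obtain a b where ab: "0 \<le> a" "a < 1 / x - 1" "1 / x - 1 < b"
          "minkowski_F b - minkowski_F a \<le> (1/2) ^ n" by (meson less_imp_le)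
        have "b > 0" using ab \<open>1 / x - 1 > 0\<close> by linarith
        \<comment> \<open>The interval is pulled back by the decreasing map
          \<open>1 / (1 + u)\<close>, so its ends change places.\<close>
        have "minkowski_F (1 / (1 + b)) = (1 - minkowski_F b) / 2"
          using minkowski_F_le1[of "1 / (1 + b)"] ab \<open>1 / x - 1 > 0\<close> by simp
        moreover have "minkowski_F (1 / (1 + a)) = (1 - minkowski_F a) / 2"
          using minkowski_F_le1[of "1 / (1 + a)"] ab by simp
        moreover have "1 / (1 + b) < x" "x < 1 / (1 + a)" "0 \<le> 1 / (1 + b)"
          using ab 2 \<open>b > 0\<close> by (auto simp: field_simps)
        moreover have "minkowski_F (1 / (1 + a)) - minkowski_F (1 / (1 + b)) \<le> (1/2) ^ Suc n"
          using calculation ab by simp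
        ultimately show ?thesis
          by (intro exI[of _ "1 / (1 + b)"] exI[of _ "1 / (1 + a)"]) auto
      next
        case 3
        \<comment> \<open>Each end lies on its own branch, and the two values differ by exactly
          \<open>minkowski_F c\<close>.\<close>
        have "minkowski_F (1 / (1 + c)) = (1 - minkowski_F c) / 2"
          using minkowski_F_le1[of "1 / (1 + c)"] c by simp
        moreover have "minkowski_F (1 + c) = (1 + minkowski_F c) / 2"
          using minkowski_F_ge1[of "1 + c"] c by simp
        moreover have "1 / (1 + c) < 1" "1 < 1 + c" "0 \<le> 1 / (1 + c)"
          using c by auto
        ultimately show ?thesis using 3 c
          by (intro exI[of _ "1 / (1 + c)"] exI[of _ "1 + c"]) (auto simp: field_simps)
      next
        case 4
        with Suc obtain a b where ab: "0 \<le> a" "a < x - 1" "x - 1 < b"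
          "minkowski_F b - minkowski_F a \<le> (1/2) ^ n" 
          by (metis diff_gt_0_iff_gt less_imp_le)
        moreover have "minkowski_F (b + 1) - minkowski_F (a + 1) \<le> (1/2) ^ Suc n"
          using minkowski_F_plus1[of a] minkowski_F_plus1[of b] ab 4 by simp
        ultimately show ?thesis
          by (intro exI[of _ "a + 1"] exI[of _ "b + 1"]) auto
      qed
    qed
  qed
  then show ?thesis using that assms by meson
qed

text \<open>Monotonicity turns small variation between two surrounding points into continuity; on
  the negative axis the function is locally constant.\<close>

lemma isCont_minkowski_F: "isCont minkowski_F x"
proof (cases "x < 0")
  case True
  have "\<forall>\<^sub>F y in nhds x. y < 0" using True by (rule order_tendstoD(2)[OF filterlim_ident])
  hence "\<forall>\<^sub>F y in nhds x. minkowski_F y = 0"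
    by eventually_elim (rule minkowski_F_neg)
  hence "isCont minkowski_F x \<longleftrightarrow> isCont (\<lambda>_. 0::real) x" by (rule isCont_cong)
  thus ?thesis by simp
next
  case False
  show ?thesis unfolding isCont_def tendsto_iff
  proof (intro allI impI)
    fix e :: real assume "e > 0"
    then obtain n where n: "(1/2) ^ n < e" using real_arch_pow_inv[of e "1/2"] by auto
    obtain a b where ab: "0 \<le> a" "a \<le> x" "x > 0 \<Longrightarrow> a < x" "x < b" "minkowski_F b - minkowski_F a \<le> (1/2) ^ n"
      using minkowski_F_small_interval[of x n] False by (metis not_less)
    \<comment> \<open>At \<open>x = 0\<close> the left end is \<open>a = 0\<close> itself; it is
      replaced by a negative point with the same value 0.\<close>
    define a' where "a' = (if x = 0 then -1 else a)"
    have a': "minkowski_F b - minkowski_F a' \<le> (1/2) ^ n" "a' < x"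
    proof -
      show "a' < x" using ab False by (auto simp: a'_def)
      show "minkowski_F b - minkowski_F a' \<le> (1/2) ^ n"
        using ab False by (auto simp: a'_def minkowski_F_neg)
    qed
    have "\<forall>\<^sub>F y in at x. y < b" "\<forall>\<^sub>F y in at x. a' < y"
      using ab a' by (auto intro: order_tendstoD[OF tendsto_ident_at])
    thus "\<forall>\<^sub>F y in at x. dist (minkowski_F y) (minkowski_F x) < e"
    proof eventually_elim
      case (elim y)
      have "minkowski_F y \<le> minkowski_F b" "minkowski_F a' \<le> minkowski_F y"
        "minkowski_F x \<le> minkowski_F b" "minkowski_F a' \<le> minkowski_F x"
        using elim ab a' by (auto intro!: minkowski_F_mono)
      thus ?case using a' n by (simp add: dist_real_def abs_less_iff)
    qed
  qed
qed

section \<open>The Minkowski measure\<close>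

abbreviation minkowski_measure :: "real measure" where
  "minkowski_measure \<equiv> interval_measure minkowski_F"

lemma minkowski_F_at_top: "(minkowski_F \<longlongrightarrow> 1) at_top"
proof (rule tendstoI)
  fix e :: real assume "e > 0"
  then obtain n where n: "(1/2) ^ n < e" using real_arch_pow_inv[of e "1/2"] by auto
  show "\<forall>\<^sub>F x in at_top. dist (minkowski_F x) 1 < e"
    using eventually_ge_at_top[of "real n"]
  proof eventually_elim
    case (elim x)
    then have "1 - (1/2) ^ n \<le> minkowski_F x"
      using minkowski_F_mono[of "real n" x] minkowski_F_of_nat[of n] by simp
    thus ?case using n minkowski_F_range(2)[of x] by (simp add: dist_real_def)
  qed
qed

lemma minkowski_F_at_bot: "(minkowski_F \<longlongrightarrow> 0) at_bot"
  by (intro tendsto_eventually eventually_mono[OF eventually_gt_at_bot[of 0]] minkowski_F_neg)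

lemma right_cont_minkowski_F: "continuous (at_right a) minkowski_F"
  using isCont_minkowski_F continuous_at_imp_continuous_at_within by blast

interpretation minkowski: real_distribution minkowski_measure
  by (rule real_distribution_interval_measure
      [OF minkowski_F_mono right_cont_minkowski_F minkowski_F_at_bot minkowski_F_at_top])

lemma cdf_minkowski: "cdf minkowski_measure = minkowski_F"
  by (rule cdf_interval_measure[OF minkowski_F_mono right_cont_minkowski_F minkowski_F_at_bot])

lemma measure_minkowski_atMost: "measure minkowski_measure {..a} = minkowski_F a"
  using fun_cong[OF cdf_minkowski, of a] by (simp add: cdf_def)

lemma measure_minkowski_greaterThan: "measure minkowski_measure {a<..} = 1 - minkowski_F a"
proof -
  have "{a<..} = UNIV - {..a}" by auto
  thus ?thesis using minkowski.prob_compl[of "{..a}"] by (simp add: measure_minkowski_atMost)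
qed

text \<open>A continuous distribution function has no atoms.\<close>

lemma AE_minkowski_neq: "AE x in minkowski_measure. x \<noteq> a"
proof -
  have "measure minkowski_measure {a} = 0"
    using minkowski.isCont_cdf[of a] isCont_minkowski_F by (simp add: cdf_minkowski)
  thus ?thesis by (intro AE_I[of _ _ "{a}"]) (auto simp: minkowski.emeasure_eq_measure)
qed

text \<open>This lets later identities be checked for positive \<open>x\<close> only, away from the
  poles of \<open>1 / x\<close> and \<open>x / (x + 1)\<close>.\<close>

lemma AE_minkowski_pos: "AE x in minkowski_measure. x > 0"
  by (rule AE_I[of _ _ "{..0}"])
    (auto simp: minkowski.emeasure_eq_measure measure_minkowski_atMost)

lemma cdf_distr_minkowski:
  assumes [measurable]: "f \<in> borel_measurable borel"
  shows "cdf (distr minkowski_measure borel f) a = measure minkowski_measure {y. f y \<le> a}"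
  by (simp add: cdf_def measure_distr vimage_def)

section \<open>Invariance and self-similarity of the measure\<close>

text \<open>The functional equation under inversion, read as an equality of distribution
  functions.\<close>

lemma distr_minkowski_inverse:
  "distr minkowski_measure borel (\<lambda>x. 1 / x) = minkowski_measure"
proof (rule cdf_unique)
  show "cdf (distr minkowski_measure borel (\<lambda>x. 1 / x)) = cdf minkowski_measure"
  proof
    fix x :: real
    have "cdf (distr minkowski_measure borel (\<lambda>x. 1 / x)) x = measure minkowski_measure {y. 1 / y \<le> x}"
      by (rule cdf_distr_minkowski) simp
    also have "\<dots> = minkowski_F x"
    proof (cases "x > 0")
      case True
      \<comment> \<open>The two sets differ on the positive axis only in the point
        \<open>1 / x\<close>, which is no atom.\<close>
      have "measure minkowski_measure {y. 1 / y \<le> x} = measure minkowski_measure {1 / x<..}"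
        using AE_minkowski_pos AE_minkowski_neq[of "1 / x"]
        by (intro minkowski.finite_measure_eq_AE, elim AE_mp, intro AE_I2)
          (use True in \<open>auto simp: field_simps\<close>)
      also have "\<dots> = minkowski_F x"
        using minkowski_F_inverse[OF True] by (simp add: measure_minkowski_greaterThan)
      finally show ?thesis .
    next
      case False
      have "measure minkowski_measure {y. 1 / y \<le> x} = measure minkowski_measure {}"
        using AE_minkowski_pos
      proof (intro minkowski.finite_measure_eq_AE, elim AE_mp, intro AE_I2 impI)
        fix y :: real assume "0 < y"
        hence "0 < 1 / y" by simp
        with False show "(y \<in> {y. 1 / y \<le> x}) = (y \<in> {})" by (auto simp del: zero_less_divide_1_iff)
      qed auto
      thus ?thesis using False minkowski_F_neg[of x] by (cases "x = 0") auto
    qed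
    finally show "cdf (distr minkowski_measure borel (\<lambda>x. 1 / x)) x = cdf minkowski_measure x"
      by (simp add: cdf_minkowski)
  qed
qed (auto simp: minkowski.real_distribution_axioms)

text \<open>The two images are the conditional measures on \<open>(1, \<infinity>)\<close> and on \<open>(-\<infinity>, 1]\<close>, each of mass \<open>1/2\<close>.\<close>

lemma cdf_uniform_minkowski:
  assumes "A \<in> sets borel" "measure minkowski_measure A = 1/2"
  shows "cdf (uniform_measure minkowski_measure A) a = 2 * measure minkowski_measure (A \<inter> {..a})"
  using assms by (simp add: cdf_def measure_uniform_measure minkowski.emeasure_eq_measure del: divide_eq_eq_numeral1 eq_divide_eq_numeral1)

lemma real_distribution_uniform_minkowski:
  assumes "A \<in> sets borel" "measure minkowski_measure A = 1/2"
  shows "real_distribution (uniform_measure minkowski_measure A)"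
proof -
  have "prob_space (uniform_measure minkowski_measure A)"
    using assms by (intro prob_space_uniform_measure) (auto simp: minkowski.emeasure_eq_measure)
  thus ?thesis by (simp add: real_distribution_def real_distribution_axioms_def)
qed

lemma integral_uniform_minkowski:
  fixes f :: "real \<Rightarrow> real"
  assumes [measurable]: "A \<in> sets borel" "f \<in> borel_measurable borel"
    and "measure minkowski_measure A = 1/2"
  shows "(\<integral>x. f x \<partial>uniform_measure minkowski_measure A) =
         2 * (\<integral>x. indicator A x * f x \<partial>minkowski_measure)"
proof -
  have "indicator A x / emeasure minkowski_measure A = ennreal (2 * indicator A x)" for x :: real
    unfolding minkowski.emeasure_eq_measure assms(3)
    using divide_ennreal[of 1 "1/2"] by (simp split: split_indicator)
  hence "uniform_measure minkowski_measure A = density minkowski_measure (\<lambda>x. ennreal (2 * indicator A x))"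
    by (simp add: uniform_measure_def)
  thus ?thesis by (simp add: integral_real_density mult.assoc)
qed

text \<open>For \<open>a \<ge> 1\<close> the shift equation says that
  \<open>minkowski_F (a - 1)\<close> is twice the mass of (1, a].\<close>

lemma distr_minkowski_plus1:
  "distr minkowski_measure borel (\<lambda>x. x + 1) = uniform_measure minkowski_measure {1<..}"
proof (rule cdf_unique)
  have m: "measure minkowski_measure {1<..} = 1/2" by (simp add: measure_minkowski_greaterThan)
  show "real_distribution (uniform_measure minkowski_measure {1<..})"
    by (rule real_distribution_uniform_minkowski) (simp_all add: m)
  show "cdf (distr minkowski_measure borel (\<lambda>x. x + 1)) = cdf (uniform_measure minkowski_measure {1<..})"
  proof
    fix a :: real
    have *: "{y. y + 1 \<le> a} = {..a - 1}" by auto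
    have "measure minkowski_measure ({1<..} \<inter> {..a}) = minkowski_F (max 1 a) - minkowski_F 1"
    proof -
      \<comment> \<open>The maximum also covers \<open>a < 1\<close>, where the intersection is
        empty.\<close>
      have "{1<..} \<inter> {..a} = {..max 1 a} - {..1}" by auto
      thus ?thesis using minkowski.finite_measure_Diff[of "{..max 1 a}" "{..1}"]
        by (simp add: measure_minkowski_atMost)
    qed
    thus "cdf (distr minkowski_measure borel (\<lambda>x. x + 1)) a = cdf (uniform_measure minkowski_measure {1<..}) a"
      using minkowski_F_ge1[of a] minkowski_F_neg[of "a - 1"]
      by (cases "a \<ge> 1") (simp_all add: cdf_distr_minkowski cdf_uniform_minkowski m * measure_minkowski_atMost max_def diff_divide_distrib add_divide_distrib)
  qed
qed auto

text \<open>For \<open>0 < a < 1\<close> the preimage ends at \<open>1 / (1 / a - 1)\<close>, where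
  \<open>minkowski_F_le1\<close> and inversion give the value
  \<open>2 * minkowski_F a\<close>.\<close>

lemma distr_minkowski_Moebius:
  "distr minkowski_measure borel (\<lambda>x. x / (x + 1)) = uniform_measure minkowski_measure {..1}"
proof (rule cdf_unique)
  have m: "measure minkowski_measure {..1} = 1/2" by (simp add: measure_minkowski_atMost)
  show "real_distribution (uniform_measure minkowski_measure {..1})"
    by (rule real_distribution_uniform_minkowski) (simp_all add: m)
  show "cdf (distr minkowski_measure borel (\<lambda>x. x / (x + 1))) = cdf (uniform_measure minkowski_measure {..1})"
  proof
    fix a :: real
    have "{..1} \<inter> {..a} = {..min 1 a}" by auto
    hence R: "cdf (uniform_measure minkowski_measure {..1}) a = 2 * minkowski_F (min 1 a)"
      by (simp add: cdf_uniform_minkowski m measure_minkowski_atMost)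
    have "cdf (distr minkowski_measure borel (\<lambda>x. x / (x + 1))) a = measure minkowski_measure {y. y / (y + 1) \<le> a}"
      by (simp add: cdf_distr_minkowski)
    also have "\<dots> = 2 * minkowski_F (min 1 a)"
    proof -
      consider "a \<le> 0" | "0 < a" "a < 1" | "a \<ge> 1" by linarith
      then show ?thesis
      proof cases
        case 1
        have "measure minkowski_measure {y. y / (y + 1) \<le> a} = measure minkowski_measure {}"
          using AE_minkowski_pos
        proof (intro minkowski.finite_measure_eq_AE, elim AE_mp, intro AE_I2 impI)
          fix x :: real assume "0 < x"
          hence "0 < x / (x + 1)" by simp
          with 1 show "(x \<in> {y. y / (y + 1) \<le> a}) = (x \<in> {})" by simp
        qed auto
        thus ?thesis using 1 minkowski_F_neg[of a] by (cases "a = 0") (auto simp: min_def)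
      next
        case 2
        have "measure minkowski_measure {y. y / (y + 1) \<le> a} = measure minkowski_measure {..1 / (1 / a - 1)}"
          using AE_minkowski_pos
          by (intro minkowski.finite_measure_eq_AE, elim AE_mp, intro AE_I2)
            (use 2 in \<open>auto simp: field_simps\<close>)
        thus ?thesis using minkowski_F_le1[of a] minkowski_F_inverse[of "1 / a - 1"] 2
          by (simp add: measure_minkowski_atMost min_def)
      next
        case 3
        have "measure minkowski_measure {y. y / (y + 1) \<le> a} = measure minkowski_measure UNIV"
          using AE_minkowski_pos
        proof (intro minkowski.finite_measure_eq_AE, elim AE_mp, intro AE_I2 impI)
          fix x :: real assume "0 < x"
          hence "x / (x + 1) \<le> 1" by simp
          with 3 show "(x \<in> {y. y / (y + 1) \<le> a}) = (x \<in> UNIV)" by simp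
        qed auto
        thus ?thesis using 3 minkowski.prob_space by (simp add: min_def)
      qed
    qed
    finally show "cdf (distr minkowski_measure borel (\<lambda>x. x / (x + 1))) a = cdf (uniform_measure minkowski_measure {..1}) a"
      using R by simp
  qed
qed auto

text \<open>Each integral on the left is twice the integral of \<open>f\<close> over one side of 1,
  and the two sides make up the line.\<close>

lemma integral_minkowski_self_similar:
  fixes f :: "real \<Rightarrow> real"
  assumes [measurable]: "f \<in> borel_measurable borel" and int: "integrable minkowski_measure f"
  shows "(\<integral>x. f (x + 1) \<partial>minkowski_measure) + (\<integral>x. f (x / (x + 1)) \<partial>minkowski_measure) =
         2 * (\<integral>x. f x \<partial>minkowski_measure)"
proof -
  have "(\<integral>x. f (x + 1) \<partial>minkowski_measure) = (\<integral>x. f x \<partial>distr minkowski_measure borel (\<lambda>x. x + 1))"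
    by (simp add: integral_distr)
  also have "\<dots> = 2 * (\<integral>x. indicator {1<..} x * f x \<partial>minkowski_measure)"
    unfolding distr_minkowski_plus1
    by (rule integral_uniform_minkowski) (simp_all add: measure_minkowski_greaterThan)
  finally have 1: "(\<integral>x. f (x + 1) \<partial>minkowski_measure) = 2 * (\<integral>x. indicator {1<..} x * f x \<partial>minkowski_measure)" .
  have "(\<integral>x. f (x / (x + 1)) \<partial>minkowski_measure) = (\<integral>x. f x \<partial>distr minkowski_measure borel (\<lambda>x. x / (x + 1)))"
    by (simp add: integral_distr)
  also have "\<dots> = 2 * (\<integral>x. indicator {..1} x * f x \<partial>minkowski_measure)"
    unfolding distr_minkowski_Moebius
    by (rule integral_uniform_minkowski) (simp_all add: measure_minkowski_atMost)
  finally have 2: "(\<integral>x. f (x / (x + 1)) \<partial>minkowski_measure) = 2 * (\<integral>x. indicator {..1} x * f x \<partial>minkowski_measure)" .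
  have "(\<integral>x. indicator {1<..} x * f x \<partial>minkowski_measure) + (\<integral>x. indicator {..1} x * f x \<partial>minkowski_measure)
     = (\<integral>x. indicator {1<..} x * f x + indicator {..1} x * f x \<partial>minkowski_measure)"
    by (rule Bochner_Integration.integral_add[symmetric])
      (use integrable_mult_indicator[OF _ int] in \<open>auto simp: real_scaleR_def\<close>)
  also have "\<dots> = (\<integral>x. f x \<partial>minkowski_measure)"
    by (rule Bochner_Integration.integral_cong) (auto split: split_indicator)
  finally show ?thesis using 1 2 by simp
qed

lemma integral_minkowski_inverse:
  fixes f :: "real \<Rightarrow> real"
  assumes [measurable]: "f \<in> borel_measurable borel"
  shows "(\<integral>x. f (1 / x) \<partial>minkowski_measure) = (\<integral>x. f x \<partial>minkowski_measure)"
proof -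
  have "(\<integral>x. f x \<partial>distr minkowski_measure borel (\<lambda>x. 1 / x)) = (\<integral>x. f (1 / x) \<partial>minkowski_measure)"
    by (simp add: integral_distr)
  thus ?thesis by (simp add: distr_minkowski_inverse)
qed

section \<open>The Bessel function\<close>

text \<open>The Wallis integrals, needed to integrate the cosine series in the Bessel integral term
  by term.\<close>

lemma has_integral_sin_even_power:
  "((\<lambda>x::real. sin x ^ (2 * k)) has_integral (pi * fact (2 * k) / (4 ^ k * (fact k)\<^sup>2))) {0..pi}"
proof (induction k)
  case 0
  show ?case using has_integral_const_real[of "1::real" 0 pi] by simp
next
  case (Suc k)
  \<comment> \<open>integration by parts: the integrand is the derivative of \<open>- cos x * sin x ^ (2 * k + 1)\<close>\<close>
  have "((\<lambda>x. sin x ^ (2 * k + 2) - real (2 * k + 1) * (cos x)\<^sup>2 * sin x ^ (2 * k)) has_integral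
          (- cos pi * sin pi ^ (2 * k + 1) - (- cos 0 * sin 0 ^ (2 * k + 1)))) {0..pi}"
  proof (rule fundamental_theorem_of_calculus)
    fix x :: real
    have "((\<lambda>x. - cos x * sin x ^ (2 * k + 1)) has_real_derivative
        (sin x ^ (2 * k + 2) - real (2 * k + 1) * (cos x)\<^sup>2 * sin x ^ (2 * k))) (at x within {0..pi})"
      by (rule derivative_eq_intros refl)+ (simp add: power2_eq_square algebra_simps)
    thus "((\<lambda>x. - cos x * sin x ^ (2 * k + 1)) has_vector_derivative
        (sin x ^ (2 * k + 2) - real (2 * k + 1) * (cos x)\<^sup>2 * sin x ^ (2 * k))) (at x within {0..pi})"
      by (simp add: has_real_derivative_iff_has_vector_derivative)
  qed simp
  hence "((\<lambda>x::real. sin x ^ (2 * k + 2) - real (2 * k + 1) * (cos x)\<^sup>2 * sin x ^ (2 * k)) has_integral 0) {0..pi}"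
    by simp
  \<comment> \<open>Adding \<open>2 * k + 1\<close> times the induction hypothesis replaces the
    squared cosine by a squared sine, leaving \<open>2 * k + 2\<close> times the next even
    power.\<close>
  from has_integral_mult_right[OF has_integral_add[OF this has_integral_mult_right[OF Suc, of "real (2 * k + 1)"]], of "1 / real (2 * k + 2)"]
  have "((\<lambda>x. 1 / real (2 * k + 2) * (sin x ^ (2 * k + 2) - real (2 * k + 1) * (cos x)\<^sup>2 * sin x ^ (2 * k)
      + real (2 * k + 1) * sin x ^ (2 * k))) has_integral
      1 / real (2 * k + 2) * (0 + real (2 * k + 1) * (pi * fact (2 * k) / (4 ^ k * (fact k)\<^sup>2)))) {0..pi}" .
  moreover have "1 / real (2 * k + 2) * (sin x ^ (2 * k + 2) - real (2 * k + 1) * (cos x)\<^sup>2 * sin x ^ (2 * k)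
      + real (2 * k + 1) * sin x ^ (2 * k)) = sin x ^ (2 * Suc k)" for x :: real
  proof -
    have "sin x ^ (2 * k + 2) - real (2 * k + 1) * (cos x)\<^sup>2 * sin x ^ (2 * k) + real (2 * k + 1) * sin x ^ (2 * k)
        = real (2 * k + 2) * sin x ^ (2 * Suc k)"
      unfolding cos_squared_eq by (simp add: power2_eq_square algebra_simps)
    thus ?thesis by simp
  qed
  moreover have "1 / real (2 * k + 2) * (0 + real (2 * k + 1) * (pi * fact (2 * k) / (4 ^ k * (fact k)\<^sup>2)))
      = pi * fact (2 * Suc k) / (4 ^ Suc k * (fact (Suc k))\<^sup>2)"
  proof -
    define c :: real where "c = pi * fact (2 * k) / (4 ^ k * (fact k)\<^sup>2)"
    have "pi * fact (2 * Suc k) / (4 ^ Suc k * (fact (Suc k))\<^sup>2) = (real (2 * k + 2) * real (2 * k + 1)) / (4 * (real k + 1)\<^sup>2) * c"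
      by (simp add: c_def power_mult_distrib mult_ac add_ac)
    also have "\<dots> = 1 / real (2 * k + 2) * (0 + real (2 * k + 1) * c)"
      by (simp add: divide_simps power2_eq_square) (simp add: algebra_simps)
    finally show ?thesis by (simp only: c_def)
  qed
  ultimately show ?case by simp
qed

text \<open>The cosine series converges uniformly on the interval, so it may be integrated termwise;
  \<open>fact (2 * k)\<close> cancels against the Wallis integral.\<close>

lemma bessel_J0_sums: "(\<lambda>k. (-1) ^ k * (z / 2) ^ (2 * k) / (fact k)\<^sup>2) sums bessel_J0 z"
proof -
  define g where "g = (\<lambda>k x. (-1) ^ k / fact (2 * k) * (z * sin x) ^ (2 * k) :: real)"
  \<comment> \<open>The majorant is the exponential series at the square of \<open>z\<close>, from
    \<open>fact k \<le> fact (2 * k)\<close>.\<close>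
  have le: "norm (g k x) \<le> (z\<^sup>2) ^ k / fact k" for k x
  proof -
    have "\<bar>z * sin x\<bar> ^ (2 * k) \<le> \<bar>z\<bar> ^ (2 * k)"
      by (intro power_mono) (auto simp: abs_mult intro: mult_left_le)
    also have "\<dots> = (z\<^sup>2) ^ k" by (simp add: power_mult)
    finally have "\<bar>z * sin x\<bar> ^ (2 * k) / fact (2 * k) \<le> (z\<^sup>2) ^ k / fact k"
      by (intro frac_le) (auto simp: fact_mono)
    thus ?thesis by (simp add: g_def abs_mult power_abs)
  qed
  have "summable (\<lambda>k. (z\<^sup>2) ^ k / fact k)"
    using summable_exp[of "z\<^sup>2"] by (simp add: field_simps)
  hence "uniform_limit {0..pi} (\<lambda>n x. \<Sum>k<n. g k x) (\<lambda>x. \<Sum>k. g k x) sequentially"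
    by (intro Weierstrass_m_test) (use le in auto)
  moreover have "(\<Sum>k. g k x) = cos (z * sin x)" for x
    using sums_unique[OF cos_paired[of "z * sin x"]] by (simp add: g_def)
  ultimately have ul: "uniform_limit {0..pi} (\<lambda>n x. \<Sum>k<n. g k x) (\<lambda>x. cos (z * sin x)) sequentially"
    by simp
  have "continuous_on {0..pi} (\<lambda>x. \<Sum>k<n. g k x)" for n
    unfolding g_def by (intro continuous_intros)
  then obtain I J where IJ: "\<And>n. ((\<lambda>x. \<Sum>k<n. g k x) has_integral I n) {0..pi}"
    "((\<lambda>x. cos (z * sin x)) has_integral J) {0..pi}" "I \<longlonglongrightarrow> J"
    using uniform_limit_integral[OF ul] by (metis sequentially_bot)
  have gi: "(g k has_integral (pi * ((-1) ^ k * (z / 2) ^ (2 * k) / (fact k)\<^sup>2))) {0..pi}" for k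
  proof -
    have "((\<lambda>x. (-1) ^ k / fact (2 * k) * z ^ (2 * k) * sin x ^ (2 * k)) has_integral
       (-1) ^ k / fact (2 * k) * z ^ (2 * k) * (pi * fact (2 * k) / (4 ^ k * (fact k)\<^sup>2))) {0..pi}"
      by (rule has_integral_mult_right[OF has_integral_sin_even_power])
    moreover have "(z / 2) ^ (2 * k) = z ^ (2 * k) / 4 ^ k" by (simp add: power_divide power_mult)
    ultimately show ?thesis by (simp add: g_def[abs_def] power_mult_distrib mult_ac)
  qed
  have "I n = (\<Sum>k<n. pi * ((-1) ^ k * (z / 2) ^ (2 * k) / (fact k)\<^sup>2))" for n
    by (rule has_integral_unique[OF IJ(1) has_integral_sum]) (use gi in auto)
  hence "I = (\<lambda>n. \<Sum>k<n. pi * ((-1) ^ k * (z / 2) ^ (2 * k) / (fact k)\<^sup>2))" ..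
  with IJ(3) have "(\<lambda>k. pi * ((-1) ^ k * (z / 2) ^ (2 * k) / (fact k)\<^sup>2)) sums J"
    by (simp only: sums_def)
  from sums_mult[OF this, of "1 / pi"] show ?thesis
    using integral_unique[OF IJ(2)] by (simp add: bessel_J0_def)
qed

text \<open>The power series presents the function as a pointwise limit of polynomials.\<close>

lemma bessel_J0_measurable [measurable]: "bessel_J0 \<in> borel_measurable borel"
proof -
  have eq: "bessel_J0 = (\<lambda>z. \<Sum>k. (-1) ^ k * (z / 2) ^ (2 * k) / (fact k)\<^sup>2)"
    using sums_unique[OF bessel_J0_sums] by blast
  show ?thesis by (subst eq) measurable
qed

lemma abs_bessel_J0_le_1: "\<bar>bessel_J0 z\<bar> \<le> 1"
proof -
  have "norm (integral {0..pi} (\<lambda>x. cos (z * sin x))) \<le> integral {0..pi} (\<lambda>x. 1)"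
    by (intro integral_norm_bound_integral integrable_continuous_interval continuous_intros) auto
  thus ?thesis by (simp add: bessel_J0_def abs_mult)
qed

section \<open>Laplace transform of the Bessel function\<close>

text \<open>The gamma integral in normalised form, as the zeroth moment of the Erlang
  density.\<close>

lemma erlang_integral:
  assumes "0 < y"
  shows "integrable lborel (erlang_density k y)" "(\<integral>t. erlang_density k y t \<partial>lborel) = 1"
proof -
  have "(\<integral>\<^sup>+ t. ennreal (erlang_density k y t) \<partial>lborel) = ennreal 1"
    using nn_integral_erlang_ith_moment[OF assms, of k 0] by simp
  hence "integrable lborel (erlang_density k y) \<and> (\<integral>t. erlang_density k y t \<partial>lborel) = 1"
    by (subst nn_integral_eq_integrable[symmetric]) (use assms in auto)
  thus "integrable lborel (erlang_density k y)" "(\<integral>t. erlang_density k y t \<partial>lborel) = 1" by auto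
qed

text \<open>Termwise integration turns the Bessel series, which has squared factorials, into an
  exponential series. The interchange is allowed because the integrals of the absolute values sum to
  \<open>exp (s / y) / y\<close>.\<close>

lemma laplace_bessel_J0:
  assumes y: "0 < y" and s: "0 \<le> s"
  shows "(\<integral>t. indicator {0..} t * (exp (- (y * t)) * bessel_J0 (2 * sqrt (s * t))) \<partial>lborel) = exp (- (s / y)) / y"
proof -
  define f where "f = (\<lambda>k t. (-1) ^ k * s ^ k / (fact k * y ^ Suc k) * erlang_density k y t)"
  \<comment> \<open>the terms of the Bessel series are multiples of Erlang densities, which integrate to 1\<close>
  have f: "f k t = indicator {0..} t * (exp (- (y * t)) * ((-1) ^ k * (s * t) ^ k / (fact k)\<^sup>2))" for k t
    using y by (auto simp: f_def erlang_density_def power_mult_distrib power2_eq_square)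
  have J: "(\<lambda>k. (-1) ^ k * (s * t) ^ k / (fact k)\<^sup>2) sums bessel_J0 (2 * sqrt (s * t))" if "t \<ge> 0" for t
    using bessel_J0_sums[of "2 * sqrt (s * t)"] s that by (simp add: power_mult)
  have fs: "(\<lambda>k. f k t) sums (indicator {0..} t * (exp (- (y * t)) * bessel_J0 (2 * sqrt (s * t))))" for t
  proof (cases "t \<ge> 0")
    case True
    show ?thesis unfolding f by (intro sums_mult J True)
  qed (simp add: f)
  have fi: "integrable lborel (f k)" "(\<integral>t. f k t \<partial>lborel) = (-1) ^ k * s ^ k / (fact k * y ^ Suc k)" for k
    unfolding f_def using erlang_integral[OF y] by auto
  have nf: "norm (f k t) = s ^ k / (fact k * y ^ Suc k) * erlang_density k y t" for k t
    using y s by (simp add: f_def abs_mult power_abs)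
  \<comment> \<open>Used at \<open>c = s\<close> for absolute convergence and at
    \<open>c = - s\<close> for the value.\<close>
  have exps: "(\<lambda>k. c ^ k / (fact k * y ^ Suc k)) sums (exp (c / y) / y)" for c
    using sums_divide[OF exp_converges[of "c / y"], of y] by (simp add: power_divide field_simps)
  have "(\<lambda>k. \<integral>t. f k t \<partial>lborel) sums (\<integral>t. (\<Sum>k. f k t) \<partial>lborel)"
  proof (rule sums_integral)
    show "AE t in lborel. summable (\<lambda>k. norm (f k t))"
    proof (rule AE_I2)
      fix t :: real
      show "summable (\<lambda>k. norm (f k t))"
      proof (cases "t \<ge> 0")
        case True
        have "norm (f k t) \<le> exp (- (y * t)) * ((s * t) ^ k / fact k)" for k
        proof -
          have "(s * t) ^ k / (fact k)\<^sup>2 \<le> (s * t) ^ k / fact k"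
            using s True by (intro divide_left_mono) (auto simp: power2_eq_square)
          hence "exp (- (y * t)) * ((s * t) ^ k / (fact k)\<^sup>2) \<le> exp (- (y * t)) * ((s * t) ^ k / fact k)"
            by (intro mult_left_mono) auto
          thus ?thesis using s True by (simp add: f abs_mult power_abs)
        qed
        moreover have "summable (\<lambda>k. exp (- (y * t)) * ((s * t) ^ k / fact k))"
          using summable_exp[of "s * t"] by (intro summable_mult) (simp add: field_simps)
        ultimately show ?thesis by (intro summable_comparison_test'[of _ 0 "\<lambda>k. norm (f k t)"]) auto
      qed (simp add: f)
    qed
    show "summable (\<lambda>k. \<integral>t. norm (f k t) \<partial>lborel)"
      unfolding nf using erlang_integral[OF y] sums_summable[OF exps[of s]] by simp
  qed (rule fi)
  moreover have "(\<lambda>k. \<integral>t. f k t \<partial>lborel) sums (exp (- (s / y)) / y)"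
    using exps[of "- s"] by (simp add: fi power_minus[of s] del: power_Suc)
  ultimately have "(\<integral>t. (\<Sum>k. f k t) \<partial>lborel) = exp (- (s / y)) / y" by (rule sums_unique2)
  thus ?thesis using sums_unique[OF fs] by simp
qed

section \<open>The integral equation\<close>

text \<open>Bounds the difference quotients of the exponential uniformly near 0.\<close>

lemma norm_exp_minus_1_le:
  fixes w :: complex
  assumes "norm w \<le> 1/2"
  shows "norm (exp w - 1) \<le> 2 * norm w"
  using norm_exp_bounds(2)[OF assms] norm_ge_zero[of w] by linarith

lemma AE_minkowski_Moebius:
  "AE x in minkowski_measure. \<bar>x / (x + 1)\<bar> \<le> 1"
  using AE_minkowski_pos by eventually_elim simp

lemma minkowski_m_eq:
  "minkowski_m t = (\<integral>x. exp (of_real (x / (x + 1)) * t) \<partial>minkowski_measure)"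
  unfolding minkowski_m_def set_lebesgue_integral_def
proof (rule integral_cong_AE)
  show "AE x in minkowski_measure. indicator {0..} x *\<^sub>R exp (complex_of_real x * t / (complex_of_real x + 1)) =
      exp (of_real (x / (x + 1)) * t)"
    using AE_minkowski_pos by eventually_elim simp
qed measurable

lemma integrable_minkowski_exp:
  "integrable minkowski_measure (\<lambda>x. exp (complex_of_real (x / (x + 1)) * t))"
proof (rule minkowski.integrable_const_bound[of _ "exp (norm t)"])
  show "AE x in minkowski_measure. norm (exp (complex_of_real (x / (x + 1)) * t)) \<le> exp (norm t)"
    using AE_minkowski_Moebius
  proof eventually_elim
    case (elim x)
    have "norm (complex_of_real (x / (x + 1)) * t) \<le> norm t"
      unfolding norm_mult norm_of_real by (intro mult_left_le_one_le elim norm_ge_zero abs_ge_zero)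
    thus ?case using norm_exp[of "complex_of_real (x / (x + 1)) * t"]
      by (meson exp_le_cancel_iff order_trans)
  qed
qed measurable

text \<open>Dominated convergence along every sequence of increments tending to 0.\<close>

lemma minkowski_m_has_field_derivative:
  "(minkowski_m has_field_derivative
     (\<integral>x. of_real (x / (x + 1)) * exp (of_real (x / (x + 1)) * t) \<partial>minkowski_measure)) (at t)"
proof -
  define y :: "real \<Rightarrow> complex" where "y = (\<lambda>x. of_real (x / (x + 1)))"
  have [measurable]: "y \<in> borel_measurable borel" unfolding y_def by measurable
  have y: "AE x in minkowski_measure. norm (y x) \<le> 1"
    using AE_minkowski_Moebius by eventually_elim (simp only: y_def norm_of_real)
  let ?D = "\<integral>x. y x * exp (y x * t) \<partial>minkowski_measure"
  \<comment> \<open>Restricting to this ball puts every increment within reach of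
    \<open>norm_exp_minus_1_le\<close>.\<close>
  have at: "at (0::complex) = at 0 within ball 0 (1/2)"
    by (rule at_within_open[symmetric]) auto
  have "((\<lambda>h. (minkowski_m (t + h) - minkowski_m t) / h) \<longlongrightarrow> ?D) (at 0)"
    unfolding at tendsto_at_iff_sequentially comp_def
  proof (intro allI impI)
    fix X :: "nat \<Rightarrow> complex"
    assume X: "\<forall>n. X n \<in> ball 0 (1/2) - {0}" "X \<longlonglongrightarrow> 0"
    have X0: "X n \<noteq> 0" "norm (X n) \<le> 1/2" for n using X(1)[rule_format, of n] by auto
    have "(minkowski_m (t + X n) - minkowski_m t) / X n =
        (\<integral>x. exp (y x * t) * ((exp (y x * X n) - 1) / X n) \<partial>minkowski_measure)" for n
    proof -
      have "(minkowski_m (t + X n) - minkowski_m t) / X n =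
        (\<integral>x. (exp (y x * (t + X n)) - exp (y x * t)) / X n \<partial>minkowski_measure)"
        unfolding minkowski_m_eq y_def
        by (subst Bochner_Integration.integral_diff[OF integrable_minkowski_exp integrable_minkowski_exp, symmetric]) simp
      also have "\<dots> = (\<integral>x. exp (y x * t) * ((exp (y x * X n) - 1) / X n) \<partial>minkowski_measure)"
        by (rule Bochner_Integration.integral_cong) (auto simp: ring_distribs exp_add diff_divide_distrib)
      finally show ?thesis .
    qed
    moreover have "(\<lambda>n. \<integral>x. exp (y x * t) * ((exp (y x * X n) - 1) / X n) \<partial>minkowski_measure) \<longlonglongrightarrow> ?D"
    \<comment> \<open>\<open>exp (norm t)\<close> bounds the exponential and 2 the difference
      quotient, as \<open>y x\<close> has norm at most 1 almost everywhere.\<close>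
    proof (rule integral_dominated_convergence[where w = "\<lambda>_. exp (norm t) * 2"])
      show "AE x in minkowski_measure. norm (exp (y x * t) * ((exp (y x * X n) - 1) / X n)) \<le> exp (norm t) * 2" for n
        using y
      proof eventually_elim
        case (elim x)
        have "norm (y x * t) \<le> norm t" unfolding norm_mult using elim by (intro mult_left_le_one_le) auto
        hence 1: "norm (exp (y x * t)) \<le> exp (norm t)"
          using norm_exp[of "y x * t"] by (meson exp_le_cancel_iff order_trans)
        have le: "norm (y x * X n) \<le> norm (X n)"
          unfolding norm_mult using elim by (intro mult_left_le_one_le) auto
        have "norm (exp (y x * X n) - 1) \<le> 2 * norm (y x * X n)"
          by (rule norm_exp_minus_1_le) (use le X0 in \<open>meson order_trans\<close>)
        also have "\<dots> \<le> 2 * norm (X n)" using le by simp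
        finally have "norm ((exp (y x * X n) - 1) / X n) \<le> 2"
          using X0[of n] by (simp add: norm_divide field_simps)
        with 1 show ?case unfolding norm_mult by (intro mult_mono) auto
      qed
      show "AE x in minkowski_measure. (\<lambda>n. exp (y x * t) * ((exp (y x * X n) - 1) / X n)) \<longlonglongrightarrow> y x * exp (y x * t)"
      proof (rule AE_I2)
        fix x
        have "((\<lambda>h. exp (y x * h)) has_field_derivative y x) (at 0)"
          by (auto intro!: derivative_eq_intros)
        hence "((\<lambda>h. (exp (y x * h) - 1) / h) \<longlongrightarrow> y x) (at 0)"
          by (simp add: DERIV_def)
        hence "(\<lambda>n. (exp (y x * X n) - 1) / X n) \<longlonglongrightarrow> y x"
          by (rule filterlim_compose) (use X X0 in \<open>auto simp: filterlim_at\<close>)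
        from tendsto_mult[OF tendsto_const[of "exp (y x * t)"] this]
        show "(\<lambda>n. exp (y x * t) * ((exp (y x * X n) - 1) / X n)) \<longlonglongrightarrow> y x * exp (y x * t)"
          by (simp add: mult.commute)
      qed
    qed auto
    ultimately show "(\<lambda>n. (minkowski_m (t + X n) - minkowski_m t) / X n) \<longlonglongrightarrow> ?D" by (simp only:)
  qed
  thus ?thesis by (simp add: DERIV_def y_def)
qed

section \<open>Reduction of both sides to one Laplace integral\<close>

lemma deriv_minkowski_m_real:
  "deriv minkowski_m (- of_real t) =
     of_real (\<integral>x. x / (x + 1) * exp (- (x / (x + 1) * t)) \<partial>minkowski_measure)"
  unfolding DERIV_imp_deriv[OF minkowski_m_has_field_derivative] integral_complex_of_real[symmetric]
  by (rule Bochner_Integration.integral_cong) (simp_all flip: exp_of_real)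

lemma minkowski_m_real:
  "minkowski_m (- of_real s) = of_real (\<integral>x. exp (- (x / (x + 1) * s)) \<partial>minkowski_measure)"
  unfolding minkowski_m_eq integral_complex_of_real[symmetric]
  by (rule Bochner_Integration.integral_cong) (simp_all flip: exp_of_real)

text \<open>Self-similarity applied to \<open>exp (- (x * s))\<close>: the shift contributes the
  factor \<open>exp (- s)\<close>, the other map gives the left-hand side. The hypothesis on
  \<open>s\<close> makes the integrand bounded.\<close>

lemma minkowski_m_laplace:
  assumes "s \<ge> 0"
  shows "minkowski_m (- of_real s) =
     of_real ((2 - exp (- s)) * (\<integral>x. exp (- (x * s)) \<partial>minkowski_measure))"
proof -
  let ?L = "\<integral>x. exp (- (x * s)) \<partial>minkowski_measure"
  have "integrable minkowski_measure (\<lambda>x. exp (- (x * s)))"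
  proof (rule minkowski.integrable_const_bound[of _ 1])
    show "AE x in minkowski_measure. norm (exp (- (x * s))) \<le> 1"
      using AE_minkowski_pos by eventually_elim (use assms in simp)
  qed measurable
  from integral_minkowski_self_similar[OF _ this]
  have "(\<integral>x. exp (- ((x + 1) * s)) \<partial>minkowski_measure) +
      (\<integral>x. exp (- (x / (x + 1) * s)) \<partial>minkowski_measure) = 2 * ?L" by simp
  moreover have "(\<integral>x. exp (- ((x + 1) * s)) \<partial>minkowski_measure) = exp (- s) * ?L"
    by (simp add: ring_distribs exp_add exp_diff exp_minus divide_inverse mult.commute)
  ultimately have "(\<integral>x. exp (- (x / (x + 1) * s)) \<partial>minkowski_measure) = (2 - exp (- s)) * ?L"
    by (simp only: left_diff_distrib)
  thus ?thesis by (simp only: minkowski_m_real)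
qed

lemma integral_minkowski_exp_inverse:
  "(\<integral>x. exp (- (s / (x / (x + 1)))) \<partial>minkowski_measure) =
     exp (- s) * (\<integral>x. exp (- (x * s)) \<partial>minkowski_measure)"
proof -
  have "(\<integral>x. exp (- (s / (x / (x + 1)))) \<partial>minkowski_measure) =
      (\<integral>x. exp (- s) * exp (- ((1 / x) * s)) \<partial>minkowski_measure)"
  proof (rule integral_cong_AE)
    show "AE x in minkowski_measure. exp (- (s / (x / (x + 1)))) = exp (- s) * exp (- ((1 / x) * s))"
      using AE_minkowski_pos
    proof eventually_elim
      case (elim x)
      hence "- (s / (x / (x + 1))) = - s + - ((1 / x) * s)" by (simp add: field_simps)
      thus ?case by (simp add: exp_add[symmetric])
    qed
  qed measurable
  also have "\<dots> = exp (- s) * (\<integral>x. exp (- (x * s)) \<partial>minkowski_measure)"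
    using integral_minkowski_inverse[of "\<lambda>x. exp (- (x * s))"] by simp
  finally show ?thesis .
qed

text \<open>The factor \<open>x / (x + 1)\<close> from the derivative makes the kernel a probability
  density in \<open>t\<close>. Absolute integrals over \<open>t\<close> are thus at most 1 for all
  \<open>x > 0\<close>, and Fubini applies since the measure is finite.\<close>

lemma minkowski_bessel_integral:
  fixes s :: real
  assumes s: "s \<ge> 0"
  defines "g \<equiv> \<lambda>t. \<integral>x. x / (x + 1) * exp (- (x / (x + 1) * t)) \<partial>minkowski_measure"
  shows "set_integrable lborel {0..} (\<lambda>t. g t * bessel_J0 (2 * sqrt (s * t)))"
    and "(LINT t:{0..}|lborel. g t * bessel_J0 (2 * sqrt (s * t))) =
           (\<integral>x. exp (- (s / (x / (x + 1)))) \<partial>minkowski_measure)"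
proof -
  interpret P: pair_sigma_finite minkowski_measure lborel ..
  define h where "h = (\<lambda>x t :: real. indicator {0..} t *
    (x / (x + 1) * (exp (- (x / (x + 1) * t)) * bessel_J0 (2 * sqrt (s * t)))))"
  have hm [measurable]: "case_prod h \<in> borel_measurable (minkowski_measure \<Otimes>\<^sub>M lborel)"
    unfolding h_def by measurable
  have bound: "norm (h x t) \<le> erlang_density 0 (x / (x + 1)) t" if "x > 0" for x t
  proof -
    have "x / (x + 1) > 0" using that by simp
    moreover from this have "x / (x + 1) * (exp (- (x / (x + 1) * t)) * \<bar>bessel_J0 (2 * sqrt (s * t))\<bar>)
       \<le> x / (x + 1) * (exp (- (x / (x + 1) * t)) * 1)"
      by (intro mult_left_mono abs_bessel_J0_le_1) auto
    ultimately show ?thesis using that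
      by (simp add: h_def erlang_density_def abs_mult split: split_indicator)
  qed
  have hi: "integrable lborel (h x)" and hn: "(\<integral>t. norm (h x t) \<partial>lborel) \<le> 1" if "x > 0" for x
  proof -
    have x: "x / (x + 1) > 0" using that by simp
    show hi: "integrable lborel (h x)"
      by (rule Bochner_Integration.integrable_bound[OF erlang_integral(1)[OF x, of 0]])
        (use bound[OF that] x in \<open>auto simp: h_def\<close>)
    have "(\<integral>t. norm (h x t) \<partial>lborel) \<le> (\<integral>t. erlang_density 0 (x / (x + 1)) t \<partial>lborel)"
      by (intro integral_mono integrable_norm hi erlang_integral(1)[OF x] bound[OF that])
    thus "(\<integral>t. norm (h x t) \<partial>lborel) \<le> 1" by (simp only: erlang_integral(2)[OF x])
  qed
  have H: "integrable (minkowski_measure \<Otimes>\<^sub>M lborel) (case_prod h)"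
  proof (rule P.Fubini_integrable[OF hm])
    show "integrable minkowski_measure (\<lambda>x. \<integral>t. norm (case_prod h (x, t)) \<partial>lborel)"
    proof (rule minkowski.integrable_const_bound[of _ 1])
      show "AE x in minkowski_measure. norm (\<integral>t. norm (case_prod h (x, t)) \<partial>lborel) \<le> 1"
        using AE_minkowski_pos
        by eventually_elim (use hn in \<open>simp add: abs_of_nonneg integral_nonneg_AE\<close>)
    qed measurable
    show "AE x in minkowski_measure. integrable lborel (\<lambda>t. case_prod h (x, t))"
      using AE_minkowski_pos by eventually_elim (use hi in simp)
  qed
  have eq: "indicator {0..} t *\<^sub>R (g t * bessel_J0 (2 * sqrt (s * t))) = (\<integral>x. h x t \<partial>minkowski_measure)" for t
  proof -
    have "(\<integral>x. h x t \<partial>minkowski_measure) = (\<integral>x. (indicator {0..} t * bessel_J0 (2 * sqrt (s * t))) *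
         (x / (x + 1) * exp (- (x / (x + 1) * t))) \<partial>minkowski_measure)"
      by (simp add: h_def mult_ac)
    also have "\<dots> = indicator {0..} t * bessel_J0 (2 * sqrt (s * t)) * g t"
      unfolding g_def by (rule integral_mult_right_zero)
    finally show ?thesis by simp
  qed
  show "set_integrable lborel {0..} (\<lambda>t. g t * bessel_J0 (2 * sqrt (s * t)))"
    unfolding set_integrable_def eq by (rule P.integrable_snd[OF H])
  have "(\<integral>t. (\<integral>x. h x t \<partial>minkowski_measure) \<partial>lborel) = (\<integral>x. (\<integral>t. h x t \<partial>lborel) \<partial>minkowski_measure)"
    by (rule P.Fubini_integral[OF H])
  also have "\<dots> = (\<integral>x. exp (- (s / (x / (x + 1)))) \<partial>minkowski_measure)"
  proof (rule integral_cong_AE)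
    show "AE x in minkowski_measure. (\<integral>t. h x t \<partial>lborel) = exp (- (s / (x / (x + 1))))"
      using AE_minkowski_pos
    proof eventually_elim
      case (elim x)
      define y where "y = x / (x + 1)"
      have y: "y > 0" using elim by (simp add: y_def)
      have "(\<integral>t. h x t \<partial>lborel) = (\<integral>t. y * (indicator {0..} t * (exp (- (y * t)) * bessel_J0 (2 * sqrt (s * t)))) \<partial>lborel)"
        by (rule Bochner_Integration.integral_cong) (simp_all add: h_def y_def)
      \<comment> \<open>The factor from the derivative cancels the \<open>1 / y\<close> of the
        Laplace transform.\<close>
      also have "\<dots> = y * (exp (- (s / y)) / y)"
        unfolding integral_mult_right_zero laplace_bessel_J0[OF y s] ..
      finally show ?case using y by (simp only: y_def[symmetric]) simp
    qed
  qed measurable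
  finally show "(LINT t:{0..}|lborel. g t * bessel_J0 (2 * sqrt (s * t))) =
           (\<integral>x. exp (- (s / (x / (x + 1)))) \<partial>minkowski_measure)"
    unfolding set_lebesgue_integral_def eq .
qed

theorem theorem2:
  fixes s :: real
  assumes "s > 0"
  shows "(\<lambda>t::real. deriv minkowski_m (- of_real t) * of_real (bessel_J0 (2 * sqrt (s * t))))
           integrable_on {0..}
       \<and> minkowski_m (- of_real s) =
           (2 * exp (of_real s) - 1) *
           integral {0..} (\<lambda>t::real. deriv minkowski_m (- of_real t) *
                                     of_real (bessel_J0 (2 * sqrt (s * t))))"
proof -
  define g where "g = (\<lambda>t. \<integral>x. x / (x + 1) * exp (- (x / (x + 1) * t)) \<partial>minkowski_measure)"
  define f where "f = (\<lambda>t. g t * bessel_J0 (2 * sqrt (s * t)))"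
  define L where "L = (\<integral>x. exp (- (x * s)) \<partial>minkowski_measure)"
  have s: "s \<ge> 0" using assms by simp
  \<comment> \<open>Passage from the Lebesgue to the gauge integral, which the claim uses.\<close>
  have int: "f integrable_on {0..}" and val: "integral {0..} f = exp (- s) * L"
    using set_borel_integral_eq_integral[OF minkowski_bessel_integral(1)[OF s]]
      minkowski_bessel_integral(2)[OF s]
    by (simp_all only: f_def g_def L_def integral_minkowski_exp_inverse)
  have "((\<lambda>t. complex_of_real (f t)) has_integral of_real (exp (- s) * L)) {0..}"
    using has_integral_of_real[OF integrable_integral[OF int]] by (simp only: val)
  moreover have "(\<lambda>t::real. deriv minkowski_m (- of_real t) * of_real (bessel_J0 (2 * sqrt (s * t)))) =
      (\<lambda>t. complex_of_real (f t))"
    by (simp only: deriv_minkowski_m_real f_def g_def of_real_mult)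
  moreover have "minkowski_m (- of_real s) = (2 * exp (of_real s) - 1) * of_real (exp (- s) * L)"
  proof -
    \<comment> \<open>Pulling out \<open>exp (- s)\<close> produces the factor of the theorem and
      leaves the value of the Bessel integral.\<close>
    have "(2 - exp (- s)) * L = (2 * exp s - 1) * (exp (- s) * L)"
      by (simp add: left_diff_distrib mult_exp_exp flip: mult.assoc)
    hence "minkowski_m (- of_real s) = of_real ((2 * exp s - 1) * (exp (- s) * L))"
      by (simp only: minkowski_m_laplace[OF s] L_def)
    thus ?thesis by (simp add: exp_of_real)
  qed
  ultimately show ?thesis by (auto simp: has_integral_integrable_integral)
qed

end
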